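(* Let $a_{12},a_{13},a_{14},a_{23},a_{24},a_{34}>0$ and let $$A=\left[\begin{array}{cccc}1 & a_{12} & a_{13} & a_{14}\\ \frac{1}{a_{12}} & 1 & a_{23} & a_{24}\\ \frac{1}{a_{13}} & \frac{1}{a_{23}} & 1 & a_{34}\\ \frac{1}{a_{14}} & \frac{1}{a_{24}} & \frac{1}{a_{34}} & 1\end{array}\right]\in\mathcal{PC}_4.$$ For $w=\left[\begin{array}{cccc}w_1&w_2&w_3&w_4\end{array}\right]^T\in\mathcal{V}_4$: (1) $w\in\mathcal{E}(A;1)$ if and only if $$\left(a_{34}w_4\leq w_3\leq\frac{w_2}{a_{23}}\leq\frac{a_{24}}{a_{23}}w_4\ \text{ or }\ a_{34}w_4\geq w_3\geq\frac{w_2}{a_{23}}\geq\frac{a_{24}}{a_{23}}w_4\right)$$ and $\min\{a_{12}w_2,a_{13}w_3,a_{14}w_4\}\leq w_1\leq\max\{a_{12}w_2,a_{13}w_3,a_{14}w_4\}$. (2) $w\in\mathcal{E}(A;2)$ if and only if $$\left(a_{34}w_4\leq w_3\leq\frac{w_1}{a_{13}}\leq\frac{a_{14}}{a_{13}}w_4\ \text{ or }\ a_{34}w_4\geq w_3\geq\frac{w_1}{a_{13}}\geq\frac{a_{14}}{a_{13}}w_4\right)$$ and $\min\left\{\frac{w_1}{a_{12}},a_{23}w_3,a_{24}w_4\right\}\leq w_2\leq\max\left\{\frac{w_1}{a_{12}},a_{23}w_3,a_{24}w_4\right\}$. (3) $w\in\mathcal{E}(A;3)$ if and only if $$\left(a_{24}w_4\leq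 w_2\leq\frac{w_1}{a_{12}}\leq\frac{a_{14}}{a_{12}}w_4\ \text{ or }\ a_{24}w_4\geq w_2\geq\frac{w_1}{a_{12}}\geq\frac{a_{14}}{a_{12}}w_4\right)$$ and $\min\left\{\frac{w_1}{a_{13}},\frac{w_2}{a_{23}},a_{34}w_4\right\}\leq w_3\leq\max\left\{\frac{w_1}{a_{13}},\frac{w_2}{a_{23}},a_{34}w_4\right\}$. (4) $w\in\mathcal{E}(A;4)$ if and only if $$\left(a_{23}w_3\leq w_2\leq\frac{w_1}{a_{12}}\leq\frac{a_{13}}{a_{12}}w_3\ \text{ or }\ a_{23}w_3\geq w_2\geq\frac{w_1}{a_{12}}\geq\frac{a_{13}}{a_{12}}w_3\right)$$ and $\min\left\{\frac{w_1}{a_{14}},\frac{w_2}{a_{24}},\frac{w_3}{a_{34}}\right\}\leq w_4\leq\max\left\{\frac{w_1}{a_{14}},\frac{w_2}{a_{24}},\frac{w_3}{a_{34}}\right\}$. Moreover, $\mathcal{E}(A)=\bigcup_{i=1}^{4}\mathcal{E}(A;i)$, and also $\mathcal{E}(A)=\bigcup_{i=1,\ i\neq p}^{4}\mathcal{E}(A;i)$ for each $p\in\{1,2,3,4\}$.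
   Context: $\mathcal{PC}_n$ is the set of $n$-by-$n$ reciprocal matrices: entrywise positive real matrices $A=[a_{ij}]$ with $a_{ji}=1/a_{ij}$ for all $1\leq i,j\leq n$. $\mathcal{V}_n$ is the set of entrywise positive real $n$-vectors. A vector $w\in\mathcal{V}_n$ is efficient for $A\in\mathcal{PC}_n$ if for every $v\in\mathcal{V}_n$, the entrywise inequalities $\left|a_{ij}-\frac{v_i}{v_j}\right|\leq\left|a_{ij}-\frac{w_i}{w_j}\right|$ for all $i,j$ imply that $v$ is proportional to $w$. $\mathcal{E}(A)$ is the set of all efficient vectors for $A$. $A(i)$ is the principal submatrix of $A$ obtained by deleting row and column $i$, and $w(i)$ is the vector obtained from $w$ by deleting its $i$th entry. (If $A$ is reciprocal, so is $A(i)$.) $\mathcal{E}(A;i)$ is the set of $w\in\mathcal{E}(A)$ such that $w(i)\in\mathcal{E}(A(i))$. *)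

theory Defs
  imports "Jordan_Normal_Form.Determinant"
begin

text \<open>Rows, columns and entries are indexed from 0, as in the matrix library, so the index
  \<open>i\<close> of the mathematical text is \<open>i - 1\<close> here.\<close>

definition reciprocal_mats :: "nat \<Rightarrow> real mat set" where
  "reciprocal_mats n = {A \<in> carrier_mat n n.
     \<forall>i<n. \<forall>j<n. A $$ (i, j) > 0 \<and> A $$ (j, i) = 1 / A $$ (i, j)}"

definition positive_vecs :: "nat \<Rightarrow> real vec set" where
  "positive_vecs n = {w \<in> carrier_vec n. \<forall>i<n. w $ i > 0}"

definition efficient :: "real mat \<Rightarrow> real vec \<Rightarrow> bool" where
  "efficient A w \<longleftrightarrow>
     w \<in> positive_vecs (dim_row A) \<and>
     (\<forall>v \<in> positive_vecs (dim_row A).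
        (\<forall>i < dim_row A. \<forall>j < dim_row A.
           \<bar>A $$ (i, j) - v $ i / v $ j\<bar> \<le> \<bar>A $$ (i, j) - w $ i / w $ j\<bar>)
        \<longrightarrow> (\<exists>c. v = c \<cdot>\<^sub>v w))"

definition efficient_vecs :: "real mat \<Rightarrow> real vec set" where
  "efficient_vecs A = {w. efficient A w}"

definition vec_delete :: "'a vec \<Rightarrow> nat \<Rightarrow> 'a vec" where
  "vec_delete w i = vec (dim_vec w - 1) (\<lambda>k. w $ (if k < i then k else Suc k))"

text \<open>The set \<open>\<E>(A; i)\<close>; \<open>mat_delete A i i\<close> is the principal submatrix \<open>A(i)\<close>.\<close>

definition efficient_vecs_del :: "real mat \<Rightarrow> nat \<Rightarrow> real vec set" where
  "efficient_vecs_del A i =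
     {w \<in> efficient_vecs A. vec_delete w i \<in> efficient_vecs (mat_delete A i i)}"

end

theory Submission
  imports Defs
begin

text \<open>Attach to a positive vector \<open>w\<close> the digraph with an edge from \<open>i\<close> to \<open>j\<close> whenever
  \<open>w_i / w_j \<ge> a_ij\<close>. Since \<open>A\<close> is reciprocal, any two vertices are joined in at least one
  direction. Everything rests on the classical fact that \<open>w\<close> is efficient if and only if this
  digraph is strongly connected (\<open>efficient_iff_strong_on\<close>): a vector \<open>v\<close> that is nowhere worse
  than \<open>w\<close> has ratios \<open>v_i / w_i\<close> increasing weakly along edges, so strong connectivity makes them
  constant; and if no edge leaves some proper nonempty set \<open>S\<close>, then scaling \<open>w\<close> up slightly on \<open>S\<close>
  improves it.

  Deleting the entry \<open>k\<close> of \<open>w\<close> together with row and column \<open>k\<close> of \<open>A\<close> deletes the vertex \<open>k\<close>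
  (\<open>efficient_delete_iff_strong_on\<close>), and a strong digraph stays strong after a vertex is added
  exactly when the new vertex has an edge out and an edge in (\<open>strong_on_remove\<close>). For order 4 this
  turns membership in \<open>\<E>(A; k)\<close> into two conditions: the three other vertices form a directed
  3-cycle, which is one of the two chains of inequalities, and the vertex \<open>k\<close> has an edge out and an
  edge in, which are the lower bound by the minimum and the upper bound by the maximum.

  The union formulas say that a strong digraph on four vertices in which any two are joined has at
  least two vertices whose deletion leaves it strong (\<open>strong_on_noncritical\<close>). It has a Hamiltonian
  cycle, and each of the two chords of this 4-cycle closes up a 3-cycle that misses exactly one
  vertex; the vertices missed for the two chords belong to different diagonal pairs, so they
  differ, and at most one of them can be a prescribed index \<open>p\<close>.\<close>

section \<open>Strong connectivity by cuts\<close>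

text \<open>Strong connectivity of the digraph \<open>R\<close> on \<open>V\<close>, in the form that no proper nonempty set of
  vertices is closed under following edges. Paths are not needed: a failing cut is directly a set of
  entries to rescale.\<close>
definition strong_on :: "'a set \<Rightarrow> ('a \<Rightarrow> 'a \<Rightarrow> bool) \<Rightarrow> bool" where
  "strong_on V R \<longleftrightarrow> (\<forall>S. S \<noteq> {} \<longrightarrow> S \<subset> V \<longrightarrow> (\<exists>i\<in>S. \<exists>j\<in>V - S. R i j))"

lemma strong_onD:
  assumes "strong_on V R" "S \<noteq> {}" "S \<subset> V"
  shows "\<exists>i\<in>S. \<exists>j\<in>V - S. R i j"
  using assms unfolding strong_on_def by blast

lemma strong_on_cut:
  assumes "strong_on V R" "S \<union> T = V" "S \<inter> T = {}" "S \<noteq> {}" "T \<noteq> {}"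
  shows "\<exists>i\<in>S. \<exists>j\<in>T. R i j"
proof -
  have "S \<subset> V" "V - S = T"
    using assms(2-5) by auto
  then show ?thesis
    using strong_onD[OF assms(1,4)] by simp
qed

text \<open>The two edges are what the cuts \<open>{k}\<close> and \<open>V - {k}\<close> require; every other cut of \<open>V\<close>
  restricts to a proper cut of \<open>V - {k}\<close>.\<close>

lemma strong_on_remove:
  assumes "k \<in> V" "V \<noteq> {k}" "strong_on (V - {k}) R"
  shows "strong_on V R \<longleftrightarrow> (\<exists>j\<in>V - {k}. R k j) \<and> (\<exists>i\<in>V - {k}. R i k)"
proof
  assume strong: "strong_on V R"
  have "{k} \<subset> V" "V - {k} \<noteq> {}" "V - {k} \<subset> V" "V - (V - {k}) = {k}"
    using assms(1,2) by auto
  then show "(\<exists>j\<in>V - {k}. R k j) \<and> (\<exists>i\<in>V - {k}. R i k)"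
    using strong_onD[OF strong, of "{k}"] strong_onD[OF strong, of "V - {k}"] by simp
next
  assume inout: "(\<exists>j\<in>V - {k}. R k j) \<and> (\<exists>i\<in>V - {k}. R i k)"
  show "strong_on V R"
    unfolding strong_on_def
  proof (intro allI impI)
    fix S assume S: "S \<noteq> {}" "S \<subset> V"
    consider "S = {k}" | "S = V - {k}" | "S - {k} \<noteq> {}" "S - {k} \<subset> V - {k}"
      using S by blast
    then show "\<exists>i\<in>S. \<exists>j\<in>V - S. R i j"
    proof cases
      case 3
      from strong_onD[OF assms(3) this] show ?thesis by blast
    qed (use inout assms(1) in auto)
  qed
qed

text \<open>Passing to a submatrix renumbers the indices, so invariance under injective renaming is
  needed to keep the original indices as vertices.\<close>

lemma strong_on_image:
  assumes inj: "inj_on f V"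
  shows "strong_on (f ` V) R \<longleftrightarrow> strong_on V (\<lambda>i j. R (f i) (f j))"
proof
  assume strong: "strong_on (f ` V) R"
  show "strong_on V (\<lambda>i j. R (f i) (f j))"
    unfolding strong_on_def
  proof (intro allI impI)
    fix T assume T: "T \<noteq> {}" "T \<subset> V"
    have "f ` T \<noteq> {}"
      using T(1) by simp
    moreover have "f ` T \<subset> f ` V"
      using inj T(2) by (rule image_strict_mono)
    ultimately obtain i j where ij: "i \<in> f ` T" "j \<in> f ` V - f ` T" "R i j"
      using strong_onD[OF strong] by metis
    then obtain a b where "a \<in> T" "i = f a" "b \<in> V" "j = f b"
      by (elim DiffE imageE)
    with ij show "\<exists>i\<in>T. \<exists>j\<in>V - T. R (f i) (f j)"
      by auto
  qed
next
  assume strong: "strong_on V (\<lambda>i j. R (f i) (f j))"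
  show "strong_on (f ` V) R"
    unfolding strong_on_def
  proof (intro allI impI)
    fix S assume S: "S \<noteq> {}" "S \<subset> f ` V"
    define T where "T = {v \<in> V. f v \<in> S}"
    have "T \<noteq> {}" "T \<subset> V"
      using S unfolding T_def by auto
    from strong_onD[OF strong this] obtain a b where "a \<in> T" "b \<in> V - T" "R (f a) (f b)"
      by blast
    then show "\<exists>i\<in>S. \<exists>j\<in>f ` V - S. R i j"
      unfolding T_def by auto
  qed
qed

section \<open>Strong digraphs on three and four vertices\<close>

lemma strong_on_cycle_3:
  assumes "R a b" "R b c" "R c a"
  shows "strong_on {a, b, c} R"
  unfolding strong_on_def
proof (intro allI impI, rule ccontr)
  fix S assume S: "S \<noteq> {}" "S \<subset> {a, b, c}"
    and "\<not> (\<exists>i\<in>S. \<exists>j\<in>{a, b, c} - S. R i j)"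
  then have "a \<in> S \<Longrightarrow> b \<in> S" "b \<in> S \<Longrightarrow> c \<in> S" "c \<in> S \<Longrightarrow> a \<in> S"
    using assms by blast+
  then show False
    using S by blast
qed

lemma strong_on_3_iff:
  assumes "distinct [a, b, c]"
    and total: "R a b \<or> R b a" "R b c \<or> R c b" "R a c \<or> R c a"
  shows "strong_on {a, b, c} R \<longleftrightarrow> (R a b \<and> R b c \<and> R c a) \<or> (R b a \<and> R c b \<and> R a c)"
proof
  assume strong: "strong_on {a, b, c} R"
  note cut = strong_on_cut[OF strong]
  have [simp]: "a \<noteq> b" "b \<noteq> a" "a \<noteq> c" "c \<noteq> a" "b \<noteq> c" "c \<noteq> b"
    using assms(1) by auto
  have "R a b \<or> R a c" "R b a \<or> R b c" "R c a \<or> R c b"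
    using cut[of "{a}" "{b, c}"] cut[of "{b}" "{a, c}"] cut[of "{c}" "{a, b}"]
    by (simp_all add: insert_commute)
  moreover have "R a c \<or> R b c" "R b a \<or> R c a" "R a b \<or> R c b"
    using cut[of "{a, b}" "{c}"] cut[of "{b, c}" "{a}"] cut[of "{a, c}" "{b}"]
    by (simp_all add: insert_commute)
  ultimately show "(R a b \<and> R b c \<and> R c a) \<or> (R b a \<and> R c b \<and> R a c)"
    using total by argo
next
  assume "(R a b \<and> R b c \<and> R c a) \<or> (R b a \<and> R c b \<and> R a c)"
  then show "strong_on {a, b, c} R"
    using strong_on_cycle_3[of R a b c] strong_on_cycle_3[of R a c b]
    by (auto simp: insert_commute)
qed

text \<open>The case of four vertices of Camion's theorem. With all six pairs joined, the fourteen
  cuts imply by propositional reasoning that one of the six possible directed 4-cycles is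
  present.\<close>

lemma hamiltonian_cycle_4:
  assumes V: "V = {a, b, c, d}" and dist: "distinct [a, b, c, d]"
    and total: "\<And>i j. i \<in> V \<Longrightarrow> j \<in> V \<Longrightarrow> R i j \<or> R j i"
    and strong: "strong_on V R"
  shows "\<exists>x y z u. V = {x, y, z, u} \<and> distinct [x, y, z, u] \<and> R x y \<and> R y z \<and> R z u \<and> R u x"
proof -
  note cut = strong_on_cut[OF strong]
  have [simp]: "a \<noteq> b" "b \<noteq> a" "a \<noteq> c" "c \<noteq> a" "a \<noteq> d" "d \<noteq> a"
    "b \<noteq> c" "c \<noteq> b" "b \<noteq> d" "d \<noteq> b" "c \<noteq> d" "d \<noteq> c"
    using dist by auto
  have cut_a: "R a b \<or> R a c \<or> R a d"
    using cut[of "{a}" "{b, c, d}"] by (simp add: V insert_commute disj_assoc)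
  have cut_b: "R b a \<or> R b c \<or> R b d"
    using cut[of "{b}" "{a, c, d}"] by (simp add: V insert_commute disj_assoc)
  have cut_c: "R c a \<or> R c b \<or> R c d"
    using cut[of "{c}" "{a, b, d}"] by (simp add: V insert_commute disj_assoc)
  have cut_d: "R d a \<or> R d b \<or> R d c"
    using cut[of "{d}" "{a, b, c}"] by (simp add: V insert_commute disj_assoc)
  have cut_ab: "R a c \<or> R a d \<or> R b c \<or> R b d"
    using cut[of "{a, b}" "{c, d}"] by (simp add: V insert_commute disj_assoc)
  have cut_ac: "R a b \<or> R a d \<or> R c b \<or> R c d"
    using cut[of "{a, c}" "{b, d}"] by (simp add: V insert_commute disj_assoc)
  have cut_ad: "R a b \<or> R a c \<or> R d b \<or> R d c"
    using cut[of "{a, d}" "{b, c}"] by (simp add: V insert_commute disj_assoc)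
  have cut_bc: "R b a \<or> R b d \<or> R c a \<or> R c d"
    using cut[of "{b, c}" "{a, d}"] by (simp add: V insert_commute disj_assoc)
  have cut_bd: "R b a \<or> R b c \<or> R d a \<or> R d c"
    using cut[of "{b, d}" "{a, c}"] by (simp add: V insert_commute disj_assoc)
  have cut_cd: "R c a \<or> R c b \<or> R d a \<or> R d b"
    using cut[of "{c, d}" "{a, b}"] by (simp add: V insert_commute disj_assoc)
  have cut_abc: "R a d \<or> R b d \<or> R c d"
    using cut[of "{a, b, c}" "{d}"] by (simp add: V insert_commute disj_assoc)
  have cut_abd: "R a c \<or> R b c \<or> R d c"
    using cut[of "{a, b, d}" "{c}"] by (simp add: V insert_commute disj_assoc)
  have cut_acd: "R a b \<or> R c b \<or> R d b"
    using cut[of "{a, c, d}" "{b}"] by (simp add: V insert_commute disj_assoc)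
  have cut_bcd: "R b a \<or> R c a \<or> R d a"
    using cut[of "{b, c, d}" "{a}"] by (simp add: V insert_commute disj_assoc)
  have pairs: "R a b \<or> R b a" "R a c \<or> R c a" "R a d \<or> R d a"
      "R b c \<or> R c b" "R b d \<or> R d b" "R c d \<or> R d c"
    using total by (auto simp: V)
  have cycles: "(R a b \<and> R b c \<and> R c d \<and> R d a) \<or> (R a b \<and> R b d \<and> R d c \<and> R c a) \<or>
     (R a c \<and> R c b \<and> R b d \<and> R d a) \<or> (R a c \<and> R c d \<and> R d b \<and> R b a) \<or>
     (R a d \<and> R d b \<and> R b c \<and> R c a) \<or> (R a d \<and> R d c \<and> R c b \<and> R b a)"
    using pairs cut_a cut_b cut_c cut_d cut_ab cut_ac cut_ad cut_bc cut_bd cut_cd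
      cut_abc cut_abd cut_acd cut_bcd
    by sat
  have closed: ?thesis
    if "V = {x, y, z, u}" "distinct [x, y, z, u]" "R x y \<and> R y z \<and> R z u \<and> R u x" for x y z u
    using that by blast
  have abcd: "V = {a, b, c, d}" "distinct [a, b, c, d]"
    using V dist by auto
  have abdc: "V = {a, b, d, c}" "distinct [a, b, d, c]"
    using V dist by auto
  have acbd: "V = {a, c, b, d}" "distinct [a, c, b, d]"
    using V dist by auto
  have acdb: "V = {a, c, d, b}" "distinct [a, c, d, b]"
    using V dist by auto
  have adbc: "V = {a, d, b, c}" "distinct [a, d, b, c]"
    using V dist by auto
  have adcb: "V = {a, d, c, b}" "distinct [a, d, c, b]"
    using V dist by auto
  show ?thesis
    using cycles closed[OF abcd] closed[OF abdc] closed[OF acbd]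
      closed[OF acdb] closed[OF adbc] closed[OF adcb]
    by argo
qed

text \<open>Let \<open>x, y, z, u\<close> be a Hamiltonian cycle. If the chord between \<open>x\<close> and \<open>z\<close> runs from \<open>x\<close> to
  \<open>z\<close>, it short-cuts \<open>y\<close>; otherwise it closes the path \<open>x, y, z\<close>, and \<open>u\<close> is left out. The chord
  between \<open>y\<close> and \<open>u\<close> frees \<open>x\<close> or \<open>z\<close> in the same way. So there are two different vertices whose
  deletion is harmless, and one of them is not \<open>p\<close>.\<close>

lemma strong_on_noncritical:
  assumes V: "V = {a, b, c, d}" and "distinct [a, b, c, d]"
    and total: "\<And>i j. i \<in> V \<Longrightarrow> j \<in> V \<Longrightarrow> R i j \<or> R j i"
    and strong: "strong_on V R"
  shows "\<exists>k\<in>V - {p}. strong_on (V - {k}) R"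
proof -
  obtain x y z u where W: "V = {x, y, z, u}" "distinct [x, y, z, u]"
    and cyc: "R x y" "R y z" "R z u" "R u x"
    using hamiltonian_cycle_4[OF assms] by blast
  have del: "V - {x} = {y, z, u}" "V - {y} = {x, z, u}" "V - {z} = {x, y, u}" "V - {u} = {x, y, z}"
    using W by auto
  have mem: "x \<in> V" "y \<in> V" "z \<in> V" "u \<in> V"
    using W by auto
  have "strong_on (V - {y}) R \<or> strong_on (V - {u}) R"
    unfolding del using total[OF mem(1,3)] strong_on_cycle_3[of R x z u]
      strong_on_cycle_3[of R x y z] cyc by argo
  then obtain k where k: "k \<in> {y, u}" "strong_on (V - {k}) R"
    by blast
  have "strong_on (V - {x}) R \<or> strong_on (V - {z}) R"
    unfolding del using total[OF mem(4,2)] strong_on_cycle_3[of R y z u]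
      strong_on_cycle_3[of R x y u] cyc by argo
  then obtain l where l: "l \<in> {x, z}" "strong_on (V - {l}) R"
    by blast
  have "k \<in> V" "l \<in> V" "k \<noteq> l"
    using k(1) l(1) W mem by auto
  with k(2) l(2) show ?thesis
    by (cases "k = p") auto
qed

section \<open>Efficiency as strong connectivity\<close>

text \<open>The edge relation of the digraph of \<open>w\<close>, with \<open>a_ij \<le> w_i / w_j\<close> cleared of the
  denominator.\<close>

definition dominates :: "real mat \<Rightarrow> real vec \<Rightarrow> nat \<Rightarrow> nat \<Rightarrow> bool" where
  "dominates A w i j \<longleftrightarrow> A $$ (i, j) * w $ j \<le> w $ i"

lemma reciprocal_matsD:
  assumes "A \<in> reciprocal_mats n"
  shows "A \<in> carrier_mat n n"
    and "i < n \<Longrightarrow> j < n \<Longrightarrow> A $$ (i, j) > 0"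
    and "i < n \<Longrightarrow> j < n \<Longrightarrow> A $$ (j, i) = 1 / A $$ (i, j)"
  using assms unfolding reciprocal_mats_def by blast+

text \<open>By reciprocity the edges at \<open>i\<close> and \<open>j\<close>, in both directions, compare the same two numbers
  \<open>a_ij w_j\<close> and \<open>w_i\<close>; in particular at least one of the edges is present.\<close>

lemma dominates_flip:
  assumes A: "A \<in> reciprocal_mats n" and "i < n" "j < n"
  shows "dominates A w j i \<longleftrightarrow> w $ i \<le> A $$ (i, j) * w $ j"
proof -
  have "A $$ (i, j) > 0" "A $$ (j, i) = 1 / A $$ (i, j)"
    using assms reciprocal_matsD(2,3)[OF A] by blast+
  then show ?thesis
    by (simp add: dominates_def pos_divide_le_eq mult.commute)
qed

lemma dominates_total:
  assumes "A \<in> reciprocal_mats n" "i < n" "j < n"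
  shows "dominates A w i j \<or> dominates A w j i"
  unfolding dominates_flip[OF assms] by (auto simp: dominates_def)

text \<open>Along an edge the error is \<open>w_i / w_j - a_ij \<ge> 0\<close>, so a competitor \<open>v\<close> that is nowhere worse
  satisfies \<open>v_i / v_j \<le> w_i / w_j\<close>, that is \<open>v_i / w_i \<le> v_j / w_j\<close>. Hence the set where
  \<open>v_i / w_i\<close> is maximal is closed under following edges, and strong connectivity makes it
  everything.\<close>

lemma efficient_if_strong_on:
  assumes A: "A \<in> reciprocal_mats n" and w: "w \<in> positive_vecs n" and n: "n > 0"
    and strong: "strong_on {0..<n} (dominates A w)"
  shows "efficient A w"
proof -
  have dim: "dim_row A = n"
    using reciprocal_matsD(1)[OF A] by simp
  have wpos: "w $ i > 0" if "i < n" for i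
    using w that by (auto simp: positive_vecs_def)
  have "\<exists>c. v = c \<cdot>\<^sub>v w"
    if v: "v \<in> positive_vecs n"
      and le: "\<forall>i<n. \<forall>j<n. \<bar>A $$ (i, j) - v $ i / v $ j\<bar> \<le> \<bar>A $$ (i, j) - w $ i / w $ j\<bar>"
    for v
  proof -
    define r where "r i = v $ i / w $ i" for i
    have vpos: "v $ i > 0" if "i < n" for i
      using v that by (auto simp: positive_vecs_def)
    have mono: "r i \<le> r j" if "i < n" "j < n" "dominates A w i j" for i j
    proof -
      have "A $$ (i, j) \<le> w $ i / w $ j"
        using that(3) wpos[OF that(2)] by (simp add: dominates_def pos_le_divide_eq)
      moreover have "\<bar>A $$ (i, j) - v $ i / v $ j\<bar> \<le> \<bar>A $$ (i, j) - w $ i / w $ j\<bar>"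
        using le that by blast
      ultimately have "v $ i / v $ j \<le> w $ i / w $ j"
        by linarith
      then show ?thesis
        using wpos[OF that(1)] wpos[OF that(2)] vpos[OF that(2)]
        by (simp add: r_def divide_simps mult.commute)
    qed
    define m where "m = Max (r ` {0..<n})"
    have le_m: "r i \<le> m" if "i < n" for i
      using that unfolding m_def by (intro Max_ge) auto
    define S where "S = {i \<in> {0..<n}. r i = m}"
    have "m \<in> r ` {0..<n}"
      using n unfolding m_def by (intro Max_in) auto
    then have "S \<noteq> {}"
      by (auto simp: S_def)
    have "S = {0..<n}"
    proof (rule ccontr)
      assume "S \<noteq> {0..<n}"
      then have "S \<subset> {0..<n}"
        by (auto simp: S_def)
      from strong_onD[OF strong \<open>S \<noteq> {}\<close> this] obtain i j
        where "i \<in> S" "j \<in> {0..<n} - S" "dominates A w i j" by blast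
      then show False
        using mono[of i j] le_m[of j] unfolding S_def by fastforce
    qed
    then have "i \<in> S" if "i < n" for i
      using that by simp
    then have r_eq: "r i = m" if "i < n" for i
      using that unfolding S_def by blast
    have "v = m \<cdot>\<^sub>v w"
    proof (rule eq_vecI)
      show "dim_vec v = dim_vec (m \<cdot>\<^sub>v w)"
        using v w by (auto simp: positive_vecs_def)
      fix i assume "i < dim_vec (m \<cdot>\<^sub>v w)"
      moreover from this have i: "i < n"
        using w by (auto simp: positive_vecs_def)
      ultimately show "v $ i = (m \<cdot>\<^sub>v w) $ i"
        using r_eq[OF i] wpos[OF i] by (simp add: r_def divide_eq_eq)
    qed
    then show ?thesis ..
  qed
  then show ?thesis
    using w unfolding efficient_def dim by blast
qed

text \<open>If no edge leaves \<open>S\<close>, then \<open>w_i / w_j < a_ij\<close> for all \<open>i\<close> in \<open>S\<close> and \<open>j\<close> outside. Scaling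
  \<open>w\<close> on \<open>S\<close> by a factor \<open>t > 1\<close> moves all ratios across the cut towards the entries of \<open>A\<close> and
  leaves the other ratios alone; as long as none of them overshoots, the scaled vector is nowhere
  worse than \<open>w\<close>, but it is not proportional to \<open>w\<close>.\<close>

lemma strong_on_if_efficient:
  assumes A: "A \<in> reciprocal_mats n" and eff: "efficient A w"
  shows "strong_on {0..<n} (dominates A w)"
  unfolding strong_on_def
proof (intro allI impI)
  fix S assume "S \<noteq> {}" and S: "S \<subset> {0..<n}"
  have dim: "dim_row A = n"
    using reciprocal_matsD(1)[OF A] by simp
  have w: "w \<in> positive_vecs n"
    using eff by (simp add: efficient_def dim)
  have wpos: "w $ i > 0" if "i < n" for i
    using w that by (auto simp: positive_vecs_def)
  have Apos: "A $$ (i, j) > 0" and Arec: "A $$ (j, i) = 1 / A $$ (i, j)" if "i < n" "j < n" for i j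
    using reciprocal_matsD[OF A] that by blast+
  show "\<exists>i\<in>S. \<exists>j\<in>{0..<n} - S. dominates A w i j"
  proof (rule ccontr)
    assume "\<not> ?thesis"
    then have lt: "w $ i < A $$ (i, j) * w $ j" if "i \<in> S" "j \<in> {0..<n} - S" for i j
      using that by (auto simp: dominates_def not_le)
    \<comment> \<open>\<open>t\<close> is the largest factor for which no ratio across the cut overshoots: the minimum of
      \<open>a_ij w_j / w_i\<close> over the cut.\<close>
    define Q where "Q = (\<lambda>(i, j). A $$ (i, j) * w $ j / w $ i) ` (S \<times> ({0..<n} - S))"
    have fin: "finite Q"
      using finite_subset[of S "{0..<n}"] S unfolding Q_def by blast
    have "Q \<noteq> {}"
      using \<open>S \<noteq> {}\<close> S unfolding Q_def by blast
    define t where "t = Min Q"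
    have "t > 1"
      unfolding t_def Min_gr_iff[OF fin \<open>Q \<noteq> {}\<close>]
    proof
      fix q assume "q \<in> Q"
      then obtain i j where ij: "i \<in> S" "j \<in> {0..<n} - S" and q: "q = A $$ (i, j) * w $ j / w $ i"
        unfolding Q_def by (elim imageE SigmaE) simp
      have "w $ i > 0"
        using ij(1) S by (intro wpos) auto
      then show "1 < q"
        using lt[OF ij] by (simp add: q)
    qed
    have t_le: "t * w $ i \<le> A $$ (i, j) * w $ j" if "i \<in> S" "j \<in> {0..<n} - S" for i j
    proof -
      have "A $$ (i, j) * w $ j / w $ i \<in> Q"
        unfolding Q_def by (rule image_eqI[of _ _ "(i, j)"]) (use that in auto)
      then have "t \<le> A $$ (i, j) * w $ j / w $ i"
        unfolding t_def by (rule Min_le[OF fin])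
      moreover have "w $ i > 0"
        using that S wpos by auto
      ultimately show ?thesis
        by (simp add: field_simps)
    qed
    define v where "v = vec n (\<lambda>i. if i \<in> S then t * w $ i else w $ i)"
    have v: "v \<in> positive_vecs n"
      using wpos \<open>t > 1\<close> by (auto simp: v_def positive_vecs_def)
    have "\<bar>A $$ (i, j) - v $ i / v $ j\<bar> \<le> \<bar>A $$ (i, j) - w $ i / w $ j\<bar>"
      if ij: "i < n" "j < n" for i j
    proof -
      note pos = wpos[OF ij(1)] wpos[OF ij(2)] Apos[OF ij]
      consider "i \<in> S \<longleftrightarrow> j \<in> S" | "i \<in> S" "j \<notin> S" | "i \<notin> S" "j \<in> S" by blast
      then show ?thesis
      proof cases
        case 1
        then have "v $ i / v $ j = w $ i / w $ j"
          using ij \<open>t > 1\<close> by (auto simp: v_def)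
        then show ?thesis by simp
      next
        case 2
        have "w $ i / w $ j \<le> v $ i / v $ j"
          using 2 ij pos \<open>t > 1\<close> by (simp add: v_def field_simps)
        moreover have "v $ i / v $ j \<le> A $$ (i, j)"
          using 2 ij pos t_le[of i j] by (simp add: v_def field_simps)
        ultimately show ?thesis by linarith
      next
        case 3
        have "v $ i / v $ j \<le> w $ i / w $ j"
          using 3 ij pos \<open>t > 1\<close> by (simp add: v_def field_simps)
        moreover have "A $$ (i, j) \<le> v $ i / v $ j"
          using 3 ij pos t_le[of j i] Arec[OF ij] \<open>t > 1\<close> by (simp add: v_def field_simps)
        ultimately show ?thesis by linarith
      qed
    qed
    then obtain c where c: "v = c \<cdot>\<^sub>v w"
      using eff v unfolding efficient_def dim by blast
    from \<open>S \<noteq> {}\<close> S obtain i j where i: "i \<in> S" "i < n" and j: "j \<notin> S" "j < n"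
      by force
    have entry: "v $ k = c * w $ k" if "k < n" for k
      using that w by (auto simp: c positive_vecs_def)
    have "c = t"
      using entry[OF i(2)] wpos[OF i(2)] i by (simp add: v_def)
    moreover have "c = 1"
      using entry[OF j(2)] wpos[OF j(2)] j by (simp add: v_def)
    ultimately show False
      using \<open>t > 1\<close> by simp
  qed
qed

lemma efficient_iff_strong_on:
  assumes "A \<in> reciprocal_mats n" "w \<in> positive_vecs n" "n > 0"
  shows "efficient A w \<longleftrightarrow> strong_on {0..<n} (dominates A w)"
  using assms efficient_if_strong_on strong_on_if_efficient by blast

text \<open>The digraph of the shortened vector is the one of \<open>w\<close> with the vertex \<open>i\<close> deleted, up to
  the renumbering \<open>insert_index i\<close>, which skips \<open>i\<close>.\<close>

lemma efficient_delete_iff_strong_on: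
  assumes A: "A \<in> reciprocal_mats n" and w: "w \<in> positive_vecs n" and "n > 1" "i < n"
  shows "efficient (mat_delete A i i) (vec_delete w i) \<longleftrightarrow>
    strong_on ({0..<n} - {i}) (dominates A w)"
proof -
  have entry_mat: "mat_delete A i i $$ (k, l) = A $$ (insert_index i k, insert_index i l)"
    if "k < n - 1" "l < n - 1" for k l
    using reciprocal_matsD(1)[OF A] that by (auto simp: mat_delete_def insert_index_def)
  have entry_vec: "vec_delete w i $ k = w $ insert_index i k" if "k < n - 1" for k
    using w that by (auto simp: vec_delete_def insert_index_def positive_vecs_def)
  have bound: "insert_index i k < n" if "k < n - 1" for k
    using that \<open>i < n\<close> by (auto simp: insert_index_def)
  have "mat_delete A i i \<in> reciprocal_mats (n - 1)"
    unfolding reciprocal_mats_def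
  proof (intro CollectI conjI allI impI)
    show "mat_delete A i i \<in> carrier_mat (n - 1) (n - 1)"
      using reciprocal_matsD(1)[OF A] by (rule mat_delete_carrier)
    fix k l assume kl: "k < n - 1" "l < n - 1"
    show "mat_delete A i i $$ (k, l) > 0"
      unfolding entry_mat[OF kl] using kl by (intro reciprocal_matsD(2)[OF A] bound)
    show "mat_delete A i i $$ (l, k) = 1 / mat_delete A i i $$ (k, l)"
      unfolding entry_mat[OF kl] entry_mat[OF kl(2,1)]
      using kl by (intro reciprocal_matsD(3)[OF A] bound)
  qed
  moreover have "vec_delete w i \<in> positive_vecs (n - 1)"
    using w bound by (auto simp: positive_vecs_def entry_vec) (auto simp: vec_delete_def)
  ultimately have "efficient (mat_delete A i i) (vec_delete w i) \<longleftrightarrow>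
      strong_on {0..<n - 1} (dominates (mat_delete A i i) (vec_delete w i))"
    using \<open>n > 1\<close> by (intro efficient_iff_strong_on) auto
  also have "\<dots> \<longleftrightarrow> strong_on {0..<n - 1}
      (\<lambda>k l. dominates A w (insert_index i k) (insert_index i l))"
    unfolding strong_on_def dominates_def
    by (intro all_cong1 imp_cong bex_cong refl) (auto simp: entry_mat entry_vec psubset_eq subset_iff)
  also have "\<dots> \<longleftrightarrow> strong_on (insert_index i ` {0..<n - 1}) (dominates A w)"
    by (rule strong_on_image[symmetric]) (auto simp: inj_on_def insert_index_def split: if_splits)
  also have "insert_index i ` {0..<n - 1} = {0..<n} - {i}"
    using insert_index_image[of i "n - 1"] \<open>i < n\<close> \<open>n > 1\<close> by simp
  finally show ?thesis .
qed

section \<open>The sets of vectors that stay efficient after a deletion\<close>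

lemma efficient_vecs_del_iff:
  assumes A: "A \<in> reciprocal_mats n" and w: "w \<in> positive_vecs n" and "n > 1" "k < n"
  shows "w \<in> efficient_vecs_del A k \<longleftrightarrow> strong_on ({0..<n} - {k}) (dominates A w) \<and>
    (\<exists>j\<in>{0..<n} - {k}. dominates A w k j) \<and> (\<exists>i\<in>{0..<n} - {k}. dominates A w i k)"
proof -
  have "card {0..<n} \<noteq> card {k}"
    using \<open>n > 1\<close> by simp
  then have "{0..<n} \<noteq> {k}"
    by metis
  then show ?thesis
    using strong_on_remove[of k "{0..<n}" "dominates A w"] assms
      efficient_delete_iff_strong_on[OF assms] efficient_iff_strong_on[OF A w]
    by (auto simp: efficient_vecs_del_def efficient_vecs_def)
qed

text \<open>The two chains of inequalities are the two orientations of a 3-cycle through \<open>x, y, z\<close>,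
  with the inequalities that involve \<open>x\<close> divided by \<open>a_xy\<close>; the bounds on \<open>w_k\<close> say that \<open>k\<close> has
  an edge out and an edge in.\<close>

lemma efficient_vecs_del_4_iff:
  assumes A: "A \<in> reciprocal_mats 4" and w: "w \<in> positive_vecs 4"
    and k: "k < 4" and rest: "{0..<4} - {k} = {x, y, z}" and dist: "distinct [x, y, z]"
  shows "w \<in> efficient_vecs_del A k \<longleftrightarrow>
    ((A $$ (y, z) * w $ z \<le> w $ y \<and> w $ y \<le> w $ x / A $$ (x, y) \<and>
        w $ x / A $$ (x, y) \<le> A $$ (x, z) / A $$ (x, y) * w $ z) \<or>
     (A $$ (y, z) * w $ z \<ge> w $ y \<and> w $ y \<ge> w $ x / A $$ (x, y) \<and>
        w $ x / A $$ (x, y) \<ge> A $$ (x, z) / A $$ (x, y) * w $ z)) \<and>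
    Min {A $$ (k, x) * w $ x, A $$ (k, y) * w $ y, A $$ (k, z) * w $ z} \<le> w $ k \<and>
    w $ k \<le> Max {A $$ (k, x) * w $ x, A $$ (k, y) * w $ y, A $$ (k, z) * w $ z}"
proof -
  let ?D = "dominates A w"
  have "x \<in> {0..<4} - {k}" "y \<in> {0..<4} - {k}" "z \<in> {0..<4} - {k}"
    unfolding rest by auto
  then have less: "x < 4" "y < 4" "z < 4"
    by auto
  note flip = dominates_flip[OF A]
  have pos: "A $$ (x, y) > 0"
    using reciprocal_matsD(2)[OF A] less by blast
  have xy: "?D x y \<longleftrightarrow> w $ y \<le> w $ x / A $$ (x, y)" "?D y x \<longleftrightarrow> w $ x / A $$ (x, y) \<le> w $ y"
    using pos flip[of x y] less by (simp_all add: dominates_def field_simps)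
  have xz: "?D x z \<longleftrightarrow> A $$ (x, z) / A $$ (x, y) * w $ z \<le> w $ x / A $$ (x, y)"
    "?D z x \<longleftrightarrow> w $ x / A $$ (x, y) \<le> A $$ (x, z) / A $$ (x, y) * w $ z"
    using pos flip[of x z] less by (simp_all add: dominates_def divide_le_cancel)
  have yz: "?D y z \<longleftrightarrow> A $$ (y, z) * w $ z \<le> w $ y" "?D z y \<longleftrightarrow> w $ y \<le> A $$ (y, z) * w $ z"
    using flip[of y z] less by (simp_all add: dominates_def)
  have outof: "(\<exists>j\<in>{x, y, z}. ?D k j) \<longleftrightarrow>
      Min {A $$ (k, x) * w $ x, A $$ (k, y) * w $ y, A $$ (k, z) * w $ z} \<le> w $ k"
    by (simp add: dominates_def Min_le_iff min_le_iff_disj)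
  have into: "(\<exists>i\<in>{x, y, z}. ?D i k) \<longleftrightarrow>
      w $ k \<le> Max {A $$ (k, x) * w $ x, A $$ (k, y) * w $ y, A $$ (k, z) * w $ z}"
    using k less by (simp add: flip le_max_iff_disj)
  have "strong_on {x, y, z} ?D \<longleftrightarrow> (?D x y \<and> ?D y z \<and> ?D z x) \<or> (?D y x \<and> ?D z y \<and> ?D x z)"
    using dist dominates_total[OF A] less by (intro strong_on_3_iff) auto
  then show ?thesis
    unfolding efficient_vecs_del_iff[OF A w _ k, simplified] rest outof into xy xz yz by blast
qed

lemma efficient_vecs_4_eq:
  assumes A: "A \<in> reciprocal_mats 4"
  shows "efficient_vecs A = (\<Union>i\<in>{0..<4} - {p}. efficient_vecs_del A i)"
proof
  show "(\<Union>i\<in>{0..<4} - {p}. efficient_vecs_del A i) \<subseteq> efficient_vecs A"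
    by (auto simp: efficient_vecs_del_def)
  show "efficient_vecs A \<subseteq> (\<Union>i\<in>{0..<4} - {p}. efficient_vecs_del A i)"
  proof
    fix w assume "w \<in> efficient_vecs A"
    then have eff: "efficient A w" by (simp add: efficient_vecs_def)
    then have w: "w \<in> positive_vecs 4"
      using reciprocal_matsD(1)[OF A] by (simp add: efficient_def)
    have "\<exists>k\<in>{0..<4} - {p}. strong_on ({0..<4} - {k}) (dominates A w)"
    proof (rule strong_on_noncritical)
      show "{0..<4} = {0, 1, 2, 3::nat}" by auto
      show "strong_on {0..<4} (dominates A w)"
        by (rule strong_on_if_efficient[OF A eff])
      show "dominates A w i j \<or> dominates A w j i" if "i \<in> {0..<4}" "j \<in> {0..<4}" for i j
        using that dominates_total[OF A, of i j] by simp
    qed simp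
    then obtain k where "k \<in> {0..<4} - {p}" "strong_on ({0..<4} - {k}) (dominates A w)"
      by blast
    then show "w \<in> (\<Union>i\<in>{0..<4} - {p}. efficient_vecs_del A i)"
      using efficient_delete_iff_strong_on[OF A w, of k] eff
      by (auto simp: efficient_vecs_del_def efficient_vecs_def)
  qed
qed

theorem mainTheorem6:
  fixes a12 a13 a14 a23 a24 a34 :: real and A :: "real mat"
  assumes "a12 > 0" "a13 > 0" "a14 > 0" "a23 > 0" "a24 > 0" "a34 > 0"
    and "A = mat_of_rows_list 4
           [[1, a12, a13, a14],
            [1 / a12, 1, a23, a24],
            [1 / a13, 1 / a23, 1, a34],
            [1 / a14, 1 / a24, 1 / a34, 1]]"
  shows "A \<in> reciprocal_mats 4 \<and>
    (\<forall>w1 w2 w3 w4 w. w = vec_of_list [w1, w2, w3, w4] \<longrightarrow> w \<in> positive_vecs 4 \<longrightarrow>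
      (w \<in> efficient_vecs_del A 0 \<longleftrightarrow>
        ((a34 * w4 \<le> w3 \<and> w3 \<le> w2 / a23 \<and> w2 / a23 \<le> a24 / a23 * w4) \<or>
         (a34 * w4 \<ge> w3 \<and> w3 \<ge> w2 / a23 \<and> w2 / a23 \<ge> a24 / a23 * w4)) \<and>
        Min {a12 * w2, a13 * w3, a14 * w4} \<le> w1 \<and>
        w1 \<le> Max {a12 * w2, a13 * w3, a14 * w4}) \<and>
      (w \<in> efficient_vecs_del A 1 \<longleftrightarrow>
        ((a34 * w4 \<le> w3 \<and> w3 \<le> w1 / a13 \<and> w1 / a13 \<le> a14 / a13 * w4) \<or>
         (a34 * w4 \<ge> w3 \<and> w3 \<ge> w1 / a13 \<and> w1 / a13 \<ge> a14 / a13 * w4)) \<and>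
        Min {w1 / a12, a23 * w3, a24 * w4} \<le> w2 \<and>
        w2 \<le> Max {w1 / a12, a23 * w3, a24 * w4}) \<and>
      (w \<in> efficient_vecs_del A 2 \<longleftrightarrow>
        ((a24 * w4 \<le> w2 \<and> w2 \<le> w1 / a12 \<and> w1 / a12 \<le> a14 / a12 * w4) \<or>
         (a24 * w4 \<ge> w2 \<and> w2 \<ge> w1 / a12 \<and> w1 / a12 \<ge> a14 / a12 * w4)) \<and>
        Min {w1 / a13, w2 / a23, a34 * w4} \<le> w3 \<and>
        w3 \<le> Max {w1 / a13, w2 / a23, a34 * w4}) \<and>
      (w \<in> efficient_vecs_del A 3 \<longleftrightarrow>
        ((a23 * w3 \<le> w2 \<and> w2 \<le> w1 / a12 \<and> w1 / a12 \<le> a13 / a12 * w3) \<or>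
         (a23 * w3 \<ge> w2 \<and> w2 \<ge> w1 / a12 \<and> w1 / a12 \<ge> a13 / a12 * w3)) \<and>
        Min {w1 / a14, w2 / a24, w3 / a34} \<le> w4 \<and>
        w4 \<le> Max {w1 / a14, w2 / a24, w3 / a34})) \<and>
    efficient_vecs A = (\<Union>i\<in>{0..<4}. efficient_vecs_del A i) \<and>
    (\<forall>p\<in>{0..<4}. efficient_vecs A = (\<Union>i\<in>{0..<4} - {p}. efficient_vecs_del A i))"
proof (intro conjI allI impI ballI)
  have entries:
    "A $$ (0, 0) = 1" "A $$ (0, 1) = a12" "A $$ (0, 2) = a13" "A $$ (0, 3) = a14"
    "A $$ (1, 0) = 1 / a12" "A $$ (1, 1) = 1" "A $$ (1, 2) = a23" "A $$ (1, 3) = a24"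
    "A $$ (2, 0) = 1 / a13" "A $$ (2, 1) = 1 / a23" "A $$ (2, 2) = 1" "A $$ (2, 3) = a34"
    "A $$ (3, 0) = 1 / a14" "A $$ (3, 1) = 1 / a24" "A $$ (3, 2) = 1 / a34" "A $$ (3, 3) = 1"
    by (simp_all add: assms(7) mat_of_rows_list_def numeral_eq_Suc)
  have less_4: "i < 4 \<longleftrightarrow> i = 0 \<or> i = 1 \<or> i = 2 \<or> i = 3" for i :: nat
    by auto
  show A: "A \<in> reciprocal_mats 4"
    using assms(1-6)
    by (auto simp: reciprocal_mats_def less_4 entries simp del: One_nat_def)
       (auto simp: assms(7) mat_of_rows_list_def)
  show "efficient_vecs A = (\<Union>i\<in>{0..<4} - {p}. efficient_vecs_del A i)" for p
    by (rule efficient_vecs_4_eq[OF A])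
  \<comment> \<open>The index 4 lies outside \<open>{0..<4}\<close>, so excluding it yields the full union.\<close>
  show "efficient_vecs A = (\<Union>i\<in>{0..<4}. efficient_vecs_del A i)"
    using efficient_vecs_4_eq[OF A, of 4] by simp
  fix w1 w2 w3 w4 w
  assume w_eq: "w = vec_of_list [w1, w2, w3, w4]" and w: "w \<in> positive_vecs 4"
  have w_nth: "w $ 0 = w1" "w $ 1 = w2" "w $ 2 = w3" "w $ 3 = w4"
    by (simp_all add: w_eq vec_of_list_index numeral_eq_Suc)
  have rest: "{0..<4::nat} - {0} = {1, 2, 3}" "{0..<4::nat} - {1} = {0, 2, 3}"
    "{0..<4::nat} - {2} = {0, 1, 3}" "{0..<4::nat} - {3} = {0, 1, 2}"
    by auto
  show "w \<in> efficient_vecs_del A 0 \<longleftrightarrow>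
        ((a34 * w4 \<le> w3 \<and> w3 \<le> w2 / a23 \<and> w2 / a23 \<le> a24 / a23 * w4) \<or>
         (a34 * w4 \<ge> w3 \<and> w3 \<ge> w2 / a23 \<and> w2 / a23 \<ge> a24 / a23 * w4)) \<and>
        Min {a12 * w2, a13 * w3, a14 * w4} \<le> w1 \<and>
        w1 \<le> Max {a12 * w2, a13 * w3, a14 * w4}"
    using efficient_vecs_del_4_iff[OF A w _ rest(1)]
    by (simp add: entries w_nth del: One_nat_def)
  show "w \<in> efficient_vecs_del A 1 \<longleftrightarrow>
        ((a34 * w4 \<le> w3 \<and> w3 \<le> w1 / a13 \<and> w1 / a13 \<le> a14 / a13 * w4) \<or>
         (a34 * w4 \<ge> w3 \<and> w3 \<ge> w1 / a13 \<and> w1 / a13 \<ge> a14 / a13 * w4)) \<and>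
        Min {w1 / a12, a23 * w3, a24 * w4} \<le> w2 \<and>
        w2 \<le> Max {w1 / a12, a23 * w3, a24 * w4}"
    using efficient_vecs_del_4_iff[OF A w _ rest(2)]
    by (simp add: entries w_nth del: One_nat_def)
  show "w \<in> efficient_vecs_del A 2 \<longleftrightarrow>
        ((a24 * w4 \<le> w2 \<and> w2 \<le> w1 / a12 \<and> w1 / a12 \<le> a14 / a12 * w4) \<or>
         (a24 * w4 \<ge> w2 \<and> w2 \<ge> w1 / a12 \<and> w1 / a12 \<ge> a14 / a12 * w4)) \<and>
        Min {w1 / a13, w2 / a23, a34 * w4} \<le> w3 \<and>
        w3 \<le> Max {w1 / a13, w2 / a23, a34 * w4}"
    using efficient_vecs_del_4_iff[OF A w _ rest(3)]
    by (simp add: entries w_nth del: One_nat_def)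
  show "w \<in> efficient_vecs_del A 3 \<longleftrightarrow>
        ((a23 * w3 \<le> w2 \<and> w2 \<le> w1 / a12 \<and> w1 / a12 \<le> a13 / a12 * w3) \<or>
         (a23 * w3 \<ge> w2 \<and> w2 \<ge> w1 / a12 \<and> w1 / a12 \<ge> a13 / a12 * w3)) \<and>
        Min {w1 / a14, w2 / a24, w3 / a34} \<le> w4 \<and>
        w4 \<le> Max {w1 / a14, w2 / a24, w3 / a34}"
    using efficient_vecs_del_4_iff[OF A w _ rest(4)]
    by (simp add: entries w_nth del: One_nat_def)
qed

end
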